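(* Let $f:D\to\mathbb{R}$ be the bivariate fractal interpolation function associated, as described in the context, with a triangle $D$ partitioned into properly $3$-coloured subtriangles $D_1,\dots,D_N$, data values $z_{nj}$ and vertical scaling factors $\alpha_{n7}\in(-1,1)$. Put $\delta_n=|\det(L_n)|$, where $\det(L_n)$ is the determinant of the linear part of $L_n$, and $$A=\sum_{n=1}^{N}\alpha_{n7}\,\delta_n,\qquad B=\sum_{n=1}^{N}\int_{D}(\alpha_{n5}u+\alpha_{n6}v+\beta_{n3})\,\delta_n\,du\,dv .$$ Then the double integral $M=\int_{D} f(x,y)\,dx\,dy$ satisfies $$M=\frac{B}{1-A}.$$
   Context: Setting. $D\subset\mathbb{R}^2$ is a (non-degenerate, closed) triangle with vertices $(x_1,y_1),(x_2,y_2),(x_3,y_3)$. It is partitioned into $N$ non-degenerate closed subtriangles $D_1,\dots,D_N$: $D=\bigcup_{n=1}^N D_n$, where distinct subtriangles meet only along common edges or at common vertices (or not at all). The graph of the partition (vertices: the vertices of the subtriangles; edges: the sides of the subtriangles) has chromatic number $3$, and a proper colouring of its vertices with colours $1,2,3$ is fixed such that the vertex $(x_j,y_j)$ of $D$ has colour $j$ for $j=1,2,3$. For each $n$, $(x_{nj},y_{nj})$ denotes the vertex of $D_n$ of colour $j$, $j=1,2,3$. Real values are prescribed at the vertices of the partition; $z_{nj}$ is the value at $(x_{nj},y_{nj})$ (so it depends only on the point), and $z_j$ is the value at $(x_j,y_j)$. Maps. For each $n$, $L_n:\mathbb{R}^2\to\mathbb{R}^2$ is the invertible affine map $L_n(x,y)=(\alpha_{n1}x+\alpha_{n2}y+\beta_{n1},\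 \alpha_{n3}x+\alpha_{n4}y+\beta_{n2})$ determined by $L_n(x_j,y_j)=(x_{nj},y_{nj})$, $j=1,2,3$ (so $L_n(D)=D_n$). Given vertical scaling factors $\alpha_{n7}\in(-1,1)$, put $F_n(x,y,z)=Q_n(x,y)+\alpha_{n7}z$ with $Q_n(x,y)=\alpha_{n5}x+\alpha_{n6}y+\beta_{n3}$, where $\alpha_{n5},\alpha_{n6},\beta_{n3}$ are determined by $F_n(x_j,y_j,z_j)=z_{nj}$, $j=1,2,3$. The bivariate fractal interpolation function $f$ of these data is the unique continuous function $f:D\to\mathbb{R}$ with $f(x_{nj},y_{nj})=z_{nj}$ for all $n,j$ and $$f(x,y)=F_n\big(L_n^{-1}(x,y),f(L_n^{-1}(x,y))\big)=\alpha_{n7}f(L_n^{-1}(x,y))+Q_n(L_n^{-1}(x,y)),\qquad (x,y)\in D_n,\ n=1,\dots,N.$$ *)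

theory Defs
  imports "HOL-Analysis.Analysis"
begin

definition triangle_vertices :: "(real^2) set \<Rightarrow> bool" where
  "triangle_vertices S \<longleftrightarrow> card S = 3 \<and> \<not> collinear S"

text \<open>\<open>S\<close> is the vertex set of the triangle \<open>D\<close>, and \<open>T n\<close>, for \<open>1 \<le> n \<le> N\<close>, is the vertex set of the
  subtriangle \<open>D\<^sub>n\<close>; the closed triangles are the convex hulls. The last clause also excludes
  \<open>D\<^sub>m = D\<^sub>n\<close> for \<open>m \<noteq> n\<close>.\<close>

definition triangle_partition :: "(real^2) set \<Rightarrow> nat \<Rightarrow> (nat \<Rightarrow> (real^2) set) \<Rightarrow> bool" where
  "triangle_partition S N T \<longleftrightarrow>
     triangle_vertices S \<and>
     (\<forall>n\<in>{1..N}. triangle_vertices (T n)) \<and>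
     convex hull S = (\<Union>n\<in>{1..N}. convex hull (T n)) \<and>
     (\<forall>m\<in>{1..N}. \<forall>n\<in>{1..N}. m \<noteq> n \<longrightarrow>
        (let I = convex hull (T m) \<inter> convex hull (T n) in
          I = {} \<or>
          (\<exists>a\<in>T m \<inter> T n. I = {a}) \<or>
          (\<exists>a\<in>T m \<inter> T n. \<exists>b\<in>T m \<inter> T n. a \<noteq> b \<and> I = closed_segment a b)))"

definition partition_vertices :: "nat \<Rightarrow> (nat \<Rightarrow> (real^2) set) \<Rightarrow> (real^2) set" where
  "partition_vertices N T = (\<Union>n\<in>{1..N}. T n)"

definition partition_edges :: "nat \<Rightarrow> (nat \<Rightarrow> (real^2) set) \<Rightarrow> (real^2) set set" where
  "partition_edges N T = {{a, b} | a b. a \<noteq> b \<and> (\<exists>n\<in>{1..N}. a \<in> T n \<and> b \<in> T n)}"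

definition proper_colouring :: "'a set \<Rightarrow> 'a set set \<Rightarrow> nat \<Rightarrow> ('a \<Rightarrow> nat) \<Rightarrow> bool" where
  "proper_colouring V E k c \<longleftrightarrow> c ` V \<subseteq> {1..k} \<and> (\<forall>a b. {a, b} \<in> E \<longrightarrow> c a \<noteq> c b)"

definition chromatic_number :: "'a set \<Rightarrow> 'a set set \<Rightarrow> nat" where
  "chromatic_number V E = (LEAST k. \<exists>c. proper_colouring V E k c)"

text \<open>Below, \<open>a i\<close> stands for \<open>\<alpha>\<^sub>n\<^sub>i\<close> (\<open>1 \<le> i \<le> 7\<close>) and \<open>b i\<close> for \<open>\<beta>\<^sub>n\<^sub>i\<close> (\<open>1 \<le> i \<le> 3\<close>), with \<open>n\<close> fixed.\<close>

definition L_map :: "(nat \<Rightarrow> real) \<Rightarrow> (nat \<Rightarrow> real) \<Rightarrow> real^2 \<Rightarrow> real^2" where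
  "L_map a b p = vector [a 1 * p$1 + a 2 * p$2 + b 1, a 3 * p$1 + a 4 * p$2 + b 2]"

definition L_linear_part :: "(nat \<Rightarrow> real) \<Rightarrow> real^2^2" where
  "L_linear_part a = vector [vector [a 1, a 2], vector [a 3, a 4]]"

lemma L_map_eq: "L_map a b p = L_linear_part a *v p + vector [b 1, b 2]"
  by (simp add: L_map_def L_linear_part_def vec_eq_iff forall_2 matrix_vector_mult_def sum_2)

definition Q_map :: "(nat \<Rightarrow> real) \<Rightarrow> (nat \<Rightarrow> real) \<Rightarrow> real^2 \<Rightarrow> real" where
  "Q_map a b p = a 5 * p$1 + a 6 * p$2 + b 3"

definition F_map :: "(nat \<Rightarrow> real) \<Rightarrow> (nat \<Rightarrow> real) \<Rightarrow> real^2 \<Rightarrow> real \<Rightarrow> real" where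
  "F_map a b p t = Q_map a b p + a 7 * t"

text \<open>\<open>w j\<close> is the vertex of \<open>D\<close> of colour \<open>j\<close> and \<open>v n j\<close> that of \<open>D\<^sub>n\<close>. The values \<open>z\<close> are prescribed as
  a function of the point, so that \<open>z\<^sub>n\<^sub>j = z (v n j)\<close> and \<open>z\<^sub>j = z (w j)\<close>. As \<open>w 1\<close>, \<open>w 2\<close>, \<open>w 3\<close> are
  affinely independent, these equations determine all coefficients except the free parameter \<open>\<alpha> n 7\<close>.\<close>

definition fif_coefficients ::
  "(nat \<Rightarrow> real^2) \<Rightarrow> nat \<Rightarrow> (nat \<Rightarrow> nat \<Rightarrow> real^2) \<Rightarrow> (real^2 \<Rightarrow> real) \<Rightarrow>
   (nat \<Rightarrow> nat \<Rightarrow> real) \<Rightarrow> (nat \<Rightarrow> nat \<Rightarrow> real) \<Rightarrow> bool" where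
  "fif_coefficients w N v z \<alpha> \<beta> \<longleftrightarrow>
     (\<forall>n\<in>{1..N}. \<alpha> n 7 \<in> {-1<..<1} \<and>
        (\<forall>j\<in>{1..3}. L_map (\<alpha> n) (\<beta> n) (w j) = v n j \<and>
                    F_map (\<alpha> n) (\<beta> n) (w j) (z (w j)) = z (v n j)))"

text \<open>A continuous function with these properties is unique on \<open>D\<close> if it exists. For scaling factors
  that differ between neighbouring subtriangles it need not exist, since the functional equations
  on a common edge may be incompatible; hence a predicate rather than a choice operator.\<close>

definition bivariate_fif ::
  "(nat \<Rightarrow> real^2) \<Rightarrow> nat \<Rightarrow> (nat \<Rightarrow> (real^2) set) \<Rightarrow> (nat \<Rightarrow> nat \<Rightarrow> real^2) \<Rightarrow> (real^2 \<Rightarrow> real) \<Rightarrow>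
   (nat \<Rightarrow> nat \<Rightarrow> real) \<Rightarrow> (nat \<Rightarrow> nat \<Rightarrow> real) \<Rightarrow> (real^2 \<Rightarrow> real) \<Rightarrow> bool" where
  "bivariate_fif w N T v z \<alpha> \<beta> f \<longleftrightarrow>
     continuous_on (convex hull (w ` {1..3})) f \<and>
     (\<forall>n\<in>{1..N}. \<forall>j\<in>{1..3}. f (v n j) = z (v n j)) \<and>
     (\<forall>n\<in>{1..N}. \<forall>p\<in>convex hull (T n).
        f p = F_map (\<alpha> n) (\<beta> n) (inv (L_map (\<alpha> n) (\<beta> n)) p) (f (inv (L_map (\<alpha> n) (\<beta> n)) p)))"

end

theory Submission
  imports Defs
begin

text \<open>Each affine map \<open>L\<^sub>n\<close> carries \<open>D\<close> onto \<open>D\<^sub>n\<close>, and the subtriangles overlap only in null sets.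
  Comparing areas gives \<open>\<Sum> \<delta>\<^sub>n = 1\<close> with all \<open>\<delta>\<^sub>n > 0\<close>, whence \<open>A < 1\<close>. Splitting \<open>M\<close> over the \<open>D\<^sub>n\<close> and
  substituting \<open>L\<^sub>n\<close> in each piece turns the functional equation into \<open>M = B + A M\<close>.\<close>

text \<open>A non-collinear set in the plane has affine dimension 2, so its hull has interior
  points; a convex set is null only if its interior is empty.\<close>

lemma measure_convex_hull_pos:
  fixes S :: "(real^2) set"
  assumes "finite S" "\<not> collinear S"
  shows "measure lebesgue (convex hull S) > 0"
proof -
  have "aff_dim S = 2"
    using assms aff_dim_le_DIM[of S] by (simp add: collinear_aff_dim)
  then have "affine hull (convex hull S) = UNIV"
    using aff_dim_eq_full[of S] by simp
  moreover have "S \<noteq> {}"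
    using assms by auto
  ultimately have "interior (convex hull S) \<noteq> {}"
    using rel_interior_eq_empty[of "convex hull S"] rel_interior_interior[of "convex hull S"]
    by simp
  then have "\<not> negligible (convex hull S)"
    by (simp add: negligible_convex_interior)
  moreover have "convex hull S \<in> lmeasurable"
    using assms by (simp add: lmeasurable_compact finite_imp_compact_convex_hull)
  ultimately show ?thesis
    using negligible_iff_measure0[of "convex hull S"] by (simp add: zero_less_measure_iff)
qed

lemma negligible_closed_segment:
  fixes a b :: "real^2"
  shows "negligible (closed_segment a b)"
proof -
  have "aff_dim (closed_segment a b) \<le> 1"
    using collinear_aff_dim collinear_closed_segment by blast
  then show ?thesis
    using low_dim_interior[of "closed_segment a b"] by (simp add: negligible_convex_interior)
qed

text \<open>Each overlap that the partition allows (nothing, a common vertex, a common edge) is a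
  null set in the plane.\<close>

lemma negligible_Int_triangles:
  assumes "triangle_partition S N T" "m \<in> {1..N}" "n \<in> {1..N}" "m \<noteq> n"
  shows "negligible (convex hull (T m) \<inter> convex hull (T n))"
  using assms unfolding triangle_partition_def Let_def
  by (metis negligible_closed_segment negligible_empty negligible_sing)

text \<open>Borel integrability of the function cut off outside \<open>K\<close> passes to the
  completed measure.\<close>

lemma absolutely_integrable_continuous_compact:
  fixes f :: "'a::euclidean_space \<Rightarrow> 'b::euclidean_space"
  assumes "compact K" "continuous_on K f"
  shows "f absolutely_integrable_on K"
proof -
  have "integrable lborel (\<lambda>x. indicator K x *\<^sub>R f x)"
    using borel_integrable_compact[OF assms] by (simp add: indicator_scaleR_eq_if)
  then show ?thesis
    unfolding set_integrable_def by (simp add: integrable_completion borel_measurable_integrable)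
qed

text \<open>The derivative is the constant map given by \<open>A\<close>, so the Jacobian factor
  leaves the integral; the nonzero determinant supplies injectivity.\<close>

lemma affine_change_of_variables_compact:
  fixes f :: "real^'n::{finite,wellorder} \<Rightarrow> real" and A :: "real^'n::_^'n::_"
  assumes "compact K" "det A \<noteq> 0" "continuous_on ((\<lambda>x. A *v x + b) ` K) f"
  shows "(f has_integral (\<bar>det A\<bar> * integral K (\<lambda>x. f (A *v x + b)))) ((\<lambda>x. A *v x + b) ` K)"
proof -
  let ?g = "\<lambda>x. A *v x + b"
  have "compact (?g ` K)"
    using assms(1) by (intro compact_continuous_image continuous_intros) auto
  then have f: "f absolutely_integrable_on (?g ` K)"
    using assms(3) absolutely_integrable_continuous_compact by blast
  have der: "(?g has_derivative (*v) A) (at x within K)" for x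
    by (auto intro!: derivative_eq_intros bounded_linear.has_derivative[OF matrix_vector_mul_bounded_linear])
  have inj: "inj_on ?g K"
    using assms(2) inj_matrix_vector_mult[of A] invertible_det_nz[of A]
    by (auto simp: inj_on_def dest: injD)
  \<comment> \<open>The substitution theorem applied next is about functions with values in some
    \<open>real^'m\<close>, so \<open>f\<close> is wrapped into \<open>real^1\<close> and unwrapped
    afterwards.\<close>
  have "(\<lambda>x. vec (f x) :: real^1) absolutely_integrable_on (?g ` K)"
    using f by (simp add: absolutely_integrable_on_1_iff)
  then have "integral K (\<lambda>x. \<bar>det (matrix ((*v) A))\<bar> *\<^sub>R (vec (f (?g x)) :: real^1))
      = integral (?g ` K) (\<lambda>x. vec (f x))"
    using has_absolute_integral_change_of_variables_compact[OF assms(1) der inj,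
        where f = "\<lambda>x. vec (f x) :: real^1"] by blast
  then have "integral K (\<lambda>x. \<bar>det A\<bar> * f (?g x)) = integral (?g ` K) f"
    by (simp add: integral_on_1_eq vec_eq_iff)
  then show ?thesis
    using f by (simp add: has_integral_iff set_lebesgue_integral_eq_integral(1))
qed

lemma measure_affine_image:
  fixes A :: "real^'n::{finite,wellorder}^'n::_"
  assumes "K \<in> lmeasurable"
  shows "measure lebesgue ((\<lambda>x. A *v x + b) ` K) = \<bar>det A\<bar> * measure lebesgue K"
proof -
  have "(\<lambda>x. A *v x + b) ` K = (+) b ` ((*v) A ` K)"
    by (simp add: image_image add.commute)
  then show ?thesis
    using assms by (simp add: measure_translation measure_linear_image)
qed

lemma affine_image_convex_hull:
  fixes A :: "real^'n^'m"
  shows "(\<lambda>x. A *v x + b) ` (convex hull S) = convex hull ((\<lambda>x. A *v x + b) ` S)"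
proof -
  have "(\<lambda>x. A *v x + b) ` X = (+) b ` ((*v) A ` X)" for X
    by (simp add: image_image add.commute)
  then show ?thesis
    by (simp add: convex_hull_translation convex_hull_linear_image)
qed

theorem mainTheorem3:
  fixes w :: "nat \<Rightarrow> real^2" and N :: nat and T :: "nat \<Rightarrow> (real^2) set"
    and c :: "real^2 \<Rightarrow> nat" and v :: "nat \<Rightarrow> nat \<Rightarrow> real^2" and z :: "real^2 \<Rightarrow> real"
    and \<alpha> \<beta> :: "nat \<Rightarrow> nat \<Rightarrow> real" and f :: "real^2 \<Rightarrow> real"
    and D :: "(real^2) set" and \<delta> :: "nat \<Rightarrow> real" and A B M :: real
  assumes "triangle_partition (w ` {1..3}) N T"
    and "chromatic_number (partition_vertices N T) (partition_edges N T) = 3"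
    and "proper_colouring (partition_vertices N T) (partition_edges N T) 3 c"
    and "\<And>j. j \<in> {1..3} \<Longrightarrow> c (w j) = j"
    and "\<And>n j. n \<in> {1..N} \<Longrightarrow> j \<in> {1..3} \<Longrightarrow> v n j \<in> T n \<and> c (v n j) = j"
    and "fif_coefficients w N v z \<alpha> \<beta>"
    and "bivariate_fif w N T v z \<alpha> \<beta> f"
    and "D = convex hull (w ` {1..3})"
    and "\<And>n. \<delta> n = \<bar>det (L_linear_part (\<alpha> n))\<bar>"
    and "A = (\<Sum>n=1..N. \<alpha> n 7 * \<delta> n)"
    and "B = (\<Sum>n=1..N. integral D (\<lambda>p. (\<alpha> n 5 * p$1 + \<alpha> n 6 * p$2 + \<beta> n 3) * \<delta> n))"
    and "M = integral D f"
  shows "1 - A \<noteq> 0 \<and> M = B / (1 - A)"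
proof -
  let ?L = "\<lambda>n. L_map (\<alpha> n) (\<beta> n)"
  let ?D = "\<lambda>n. convex hull (T n)"
  have triD: "triangle_vertices (w ` {1..3})" and triT: "\<And>n. n \<in> {1..N} \<Longrightarrow> triangle_vertices (T n)"
    and cover: "D = (\<Union>n\<in>{1..N}. ?D n)"
    using assms(1,8) by (auto simp: triangle_partition_def)
  have compD: "compact D"
    using assms(8) by (simp add: finite_imp_compact_convex_hull)
  \<comment> \<open>Finiteness of \<open>T n\<close> comes from its cardinality 3, since infinite
    sets have \<open>card\<close> 0.\<close>
  have compT: "compact (?D n)" if "n \<in> {1..N}" for n
    using triT[OF that] unfolding triangle_vertices_def
    by (intro finite_imp_compact_convex_hull) (simp add: card_ge_0_finite)
  have posD: "measure lebesgue D > 0"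
    using triD assms(8) by (simp add: triangle_vertices_def measure_convex_hull_pos)
  have posT: "measure lebesgue (?D n) > 0" if "n \<in> {1..N}" for n
    using triT[OF that] unfolding triangle_vertices_def
    by (intro measure_convex_hull_pos) (simp_all add: card_ge_0_finite)
  have disj: "pairwise (\<lambda>m n. negligible (?D m \<inter> ?D n)) {1..N}"
    using negligible_Int_triangles[OF assms(1)] by (auto simp: pairwise_def)
  \<comment> \<open>The colouring \<open>c\<close> is a left inverse of \<open>v n\<close> on the
    colours, so \<open>v n\<close> picks three distinct points of the three-point set
    \<open>T n\<close>.\<close>
  have Tv: "T n = v n ` {1..3}" if n: "n \<in> {1..N}" for n
  proof (rule sym, rule card_subset_eq)
    show "finite (T n)" and sub: "v n ` {1..3} \<subseteq> T n"
      using triT[OF n] assms(5)[OF n] by (auto simp: triangle_vertices_def card_ge_0_finite)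
    have "inj_on (v n) {1..3}"
      using assms(5)[OF n] by (metis inj_onI)
    then show "card (v n ` {1..3}) = card (T n)"
      using triT[OF n] by (simp add: card_image triangle_vertices_def)
  qed
  have Leq: "?L n = (\<lambda>p. L_linear_part (\<alpha> n) *v p + vector [\<beta> n 1, \<beta> n 2])" for n
    by (simp add: fun_eq_iff L_map_eq)
  \<comment> \<open>The interpolation conditions send the vertices of \<open>D\<close> onto those of
    the subtriangle, and affine maps commute with convex hulls.\<close>
  have LD: "?L n ` D = ?D n" if n: "n \<in> {1..N}" for n
  proof -
    have "?L n ` w ` {1..3} = T n"
      using assms(6) n by (simp add: Tv image_image fif_coefficients_def)
    then show ?thesis
      unfolding assms(8) Leq by (simp add: affine_image_convex_hull)
  qed
  have area: "measure lebesgue (?D n) = \<delta> n * measure lebesgue D" if "n \<in> {1..N}" for n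
    using measure_affine_image[OF lmeasurable_compact[OF compD]] LD[OF that, symmetric]
    by (simp add: Leq assms(9))
  \<comment> \<open>A zero determinant would collapse the subtriangle to area 0. Positivity is used
    both for the bound on \<open>A\<close> and for the invertibility of \<open>?L n\<close>.\<close>
  have \<delta>pos: "\<delta> n > 0" if "n \<in> {1..N}" for n
    using posT[OF that] posD area[OF that] by (simp add: zero_less_mult_iff)
  have "measure lebesgue D = (\<Sum>n=1..N. \<delta> n) * measure lebesgue D"
    using measure_negligible_finite_Union_image[OF _ lmeasurable_compact[OF compT] disj] area
    unfolding cover[symmetric] by (simp add: sum_distrib_right)
  then have sum\<delta>: "(\<Sum>n=1..N. \<delta> n) = 1"
    using posD by simp
  have "A < (\<Sum>n=1..N. \<delta> n)"
    unfolding assms(10)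
  proof (rule sum_strict_mono)
    \<comment> \<open>With no subtriangles the sum would be 0 instead of 1.\<close>
    show "{1..N} \<noteq> {}"
      using sum\<delta> by force
    show "\<alpha> n 7 * \<delta> n < \<delta> n" if "n \<in> {1..N}" for n
      using \<delta>pos[OF that] assms(6) that by (simp add: fif_coefficients_def)
  qed simp
  then have A: "A < 1"
    using sum\<delta> by simp

  have contf: "continuous_on D f"
    using assms(7,8) by (simp add: bivariate_fif_def)
  have contQ: "continuous_on D (Q_map (\<alpha> n) (\<beta> n))" for n
    unfolding Q_map_def by (intro continuous_intros)
  have int: "g integrable_on D" if "continuous_on D g" for g :: "real^2 \<Rightarrow> real"
    using absolutely_integrable_continuous_compact[OF compD that]
    by (simp add: set_lebesgue_integral_eq_integral(1))
  \<comment> \<open>\<open>?I n\<close> is the \<open>n\<close>-th summand of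
    \<open>B + A * M\<close>, with the constant \<open>\<delta> n\<close> pulled out of the integral
    in \<open>B\<close>.\<close>
  let ?I = "\<lambda>n. integral D (Q_map (\<alpha> n) (\<beta> n)) * \<delta> n + \<alpha> n 7 * \<delta> n * M"
  have piece: "(f has_integral ?I n) (?D n)" if n: "n \<in> {1..N}" for n
  proof -
    have det: "det (L_linear_part (\<alpha> n)) \<noteq> 0"
      using \<delta>pos[OF n] by (simp add: assms(9))
    \<comment> \<open>Injectivity is needed on the whole plane, because \<open>inv\<close> in the
      functional equation is the inverse of \<open>?L n\<close> as a map on all of
      \<open>real^2\<close>.\<close>
    have injL: "inj (?L n)"
      using inj_matrix_vector_mult[of "L_linear_part (\<alpha> n)"] det invertible_det_nz
      by (auto simp: inj_on_def Leq)
    have fL: "f (?L n p) = Q_map (\<alpha> n) (\<beta> n) p + \<alpha> n 7 * f p" if "p \<in> D" for p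
    proof -
      have "?L n p \<in> ?D n"
        using LD[OF n] that by blast
      then show ?thesis
        using assms(7) n injL by (simp add: bivariate_fif_def F_map_def)
    qed
    have "?D n \<subseteq> D"
      using cover n by blast
    then have "continuous_on (?L n ` D) f"
      using contf continuous_on_subset by (simp add: LD[OF n])
    then have "(f has_integral (\<delta> n * integral D (\<lambda>p. f (?L n p)))) (?L n ` D)"
      using affine_change_of_variables_compact[OF compD det] by (simp add: Leq assms(9))
    moreover have "integral D (\<lambda>p. f (?L n p))
        = integral D (\<lambda>p. Q_map (\<alpha> n) (\<beta> n) p + \<alpha> n 7 * f p)"
      by (rule Henstock_Kurzweil_Integration.integral_cong) (rule fL)
    moreover have "\<dots> = integral D (Q_map (\<alpha> n) (\<beta> n)) + \<alpha> n 7 * M"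
      unfolding assms(12)
      by (subst Henstock_Kurzweil_Integration.integral_add)
        (auto intro!: int contQ contf continuous_intros)
    ultimately show ?thesis
      by (simp add: LD[OF n] algebra_simps)
  qed
  have "(f has_integral (\<Sum>n=1..N. ?I n)) D"
    using has_integral_UN[OF _ piece disj] unfolding cover[symmetric] by simp
  then have "M = (\<Sum>n=1..N. ?I n)"
    unfolding assms(12) by (rule integral_unique)
  also have "\<dots> = B + A * M"
    unfolding assms(10,11) by (simp add: Q_map_def[abs_def] sum.distrib sum_distrib_right)
  finally have "M * (1 - A) = B"
    by (simp add: algebra_simps)
  \<comment> \<open>Since \<open>A < 1\<close>, the quotient is a genuine one and not the default
    value of division by zero.\<close>
  then show ?thesis
    using A by (auto simp: field_simps)
qed

end
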